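(* Let $a\neq0$ and $x$ be real numbers and let $n,m\ge1$ be integers. Then $$\mathrm{C.T.}\big|_{\mathbf{z}=0}\ \prod_{j=1}^ne^{-az_j}\frac{(1+z_j)^{x}}{z_j^{m+n-1}}\prod_{1\le i<j\le n}(z_i-z_j)^2=(-1)^{\binom n2+nm}\,n!\,\det\left(c_{n+i-1}^{-a}(-x+j-1)\right)_{i,j=1}^m.$$
   Context: $\mathrm{C.T.}|_{\mathbf{z}=0}F(\mathbf{z})$ is the constant term of the Laurent expansion of $F$ at $\mathbf{z}=(z_1,\dots,z_n)=(0,\dots,0)$; $(1+z)^x$ is expanded as the binomial series in $z$. The Charlier polynomials $c_n^a$ are defined by the generating function $(1+z)^xe^{-az}=\sum_{n=0}^\infty c_n^a(x)z^n$. *)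

theory Defs
  imports "HOL-Complex_Analysis.Complex_Analysis" "Jordan_Normal_Form.Determinant"
begin

text \<open>
  A Laurent expansion at the origin in the variables \<open>z i\<close>, \<open>i \<in> I\<close>: a (possibly bi-infinite)
  series that converges unconditionally to \<open>F\<close> on some punctured polydisc
  \<open>0 < |z i| < r\<close>. Its coefficients on \<open>I \<rightarrow>\<^sub>E UNIV\<close> are determined by \<open>F\<close>, so
  the description operator in \<open>constant_term\<close> is well defined as soon as an expansion exists.
\<close>

definition is_laurent_expansion_at_0 ::
    "'i set \<Rightarrow> (('i \<Rightarrow> complex) \<Rightarrow> complex) \<Rightarrow> (('i \<Rightarrow> int) \<Rightarrow> complex) \<Rightarrow> bool" where
  "is_laurent_expansion_at_0 I F c \<longleftrightarrow>
     (\<exists>r>0. \<forall>z. (\<forall>i\<in>I. 0 < norm (z i) \<and> norm (z i) < r) \<longrightarrow>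
        ((\<lambda>k. c k * (\<Prod>i\<in>I. z i powi k i)) has_sum F z) (I \<rightarrow>\<^sub>E UNIV))"

definition constant_term :: "'i set \<Rightarrow> (('i \<Rightarrow> complex) \<Rightarrow> complex) \<Rightarrow> complex" where
  "constant_term I F =
     (THE t. \<exists>c. is_laurent_expansion_at_0 I F c \<and> t = c (\<lambda>i\<in>I. 0))"

text \<open>
  \<open>charlier a n x\<close> is $c_n^a(x)$; the generating function $(1+z)^x e^{-az}$ is read as a formal
  power series in $z$, \<open>fps_binomial x\<close> being the binomial series of $(1+z)^x$.
\<close>

definition charlier :: "real \<Rightarrow> nat \<Rightarrow> real \<Rightarrow> real" where
  "charlier a n x = fps_nth (fps_binomial x * fps_exp (- a)) n"

end

theory Submission
  imports Defs
begin

text \<open>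
  Write \<open>F = (1 + z)\<^sup>x e\<^sup>-\<^sup>a\<^sup>z\<close> and \<open>G = 1 / F\<close>. Expanding both Vandermonde factors as sums over
  permutations turns the constant term into \<open>n!\<close> times the Hankel determinant of the coefficients
  \<open>F\<^bsub>m+n-1-i-j\<^esub>\<close>, \<open>0 \<le> i, j < n\<close>; reversing its rows gives the Toeplitz determinant of the
  \<open>F\<^bsub>m+i-j\<^esub>\<close> and the sign \<open>(-1)\<close> to the power \<open>n choose 2\<close>. By Jacobi's complementary minor theorem (the
  duality between the two Jacobi-Trudi formulas for the rectangular shape \<open>m\<^sup>n\<close>) this equals, up to
  \<open>(-1)\<^bsup>nm\<^esup>\<close>, the \<open>m \<times> m\<close> determinant of the \<open>G\<^bsub>n+i-j\<^esub>\<close>. Since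
  \<open>(1 + z)\<^sup>j G\<close> generates the Charlier polynomials at \<open>-x + j\<close>, unitriangular column operations lead to
  the right-hand side.
\<close>

subsection \<open>Determinants\<close>

text \<open>Passing to Laurent series allows integer indices: coefficients at negative indices are
  0, so Toeplitz and Hankel entries need no truncated subtraction.\<close>

abbreviation fps_coeff :: "'a::zero fps \<Rightarrow> int \<Rightarrow> 'a" where
  "fps_coeff F k \<equiv> fls_nth (fps_to_fls F) k"

section \<open>Triangular, Vandermonde and antidiagonal determinants\<close>

lemma det_lower_unitriangular:
  fixes A :: "'a::comm_ring_1 mat"
  assumes "A \<in> carrier_mat n n"
    and "\<And>i j. i < j \<Longrightarrow> j < n \<Longrightarrow> A $$ (i, j) = 0" and "\<And>i. i < n \<Longrightarrow> A $$ (i, i) = 1"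
  shows "Determinant.det A = 1"
proof -
  have "Determinant.det A = prod_list (diag_mat A)"
    using assms by (intro det_lower_triangular)
  also have "\<dots> = (\<Prod>i=0..<n. A $$ (i, i))"
    using assms by (simp add: prod_list_diag_prod)
  finally show ?thesis using assms(3) by simp
qed

lemma det_upper_unitriangular:
  fixes A :: "'a::comm_ring_1 mat"
  assumes "A \<in> carrier_mat n n"
    and "\<And>i j. j < i \<Longrightarrow> i < n \<Longrightarrow> A $$ (i, j) = 0" and "\<And>i. i < n \<Longrightarrow> A $$ (i, i) = 1"
  shows "Determinant.det A = 1"
proof -
  have "Determinant.det (transpose_mat A) = 1"
    using assms by (intro det_lower_unitriangular[of _ n]) auto
  thus ?thesis using det_transpose[OF assms(1)] by simp
qed

lemma mat_mult_mat:
  "Matrix.mat n k f * Matrix.mat k m g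
     = Matrix.mat n m (\<lambda>(i, j). \<Sum>l<k. f (i, l) * g (l, j))"
  by (intro eq_matI) (auto simp: scalar_prod_def lessThan_atLeast0)

text \<open>Column operations replace the monomials by the monic Newton polynomials
  \<open>p j\<close>, with roots \<open>w i\<close> for \<open>i < j\<close>. The entry
  \<open>poly (p j) (w i)\<close> vanishes for \<open>i < j\<close>, so the new matrix is lower
  triangular and its diagonal gives the product.\<close>

lemma det_Vandermonde:
  fixes w :: "nat \<Rightarrow> 'a::idom"
  shows "Determinant.det (Matrix.mat n n (\<lambda>(i, j). w i ^ j)) = (\<Prod>j<n. \<Prod>i<j. (w j - w i))"
proof -
  define p where "p k = (\<Prod>i<k. [:- w i, 1:])" for k
  have deg: "degree (p k) = k" for k
    unfolding p_def by (subst degree_prod_eq_sum_degree) auto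
  have lead: "coeff (p k) k = 1" for k
  proof -
    have "lead_coeff (p k) = 1" unfolding p_def by (subst lead_coeff_prod) auto
    thus ?thesis by (simp add: deg)
  qed
  let ?V = "Matrix.mat n n (\<lambda>(i, j). w i ^ j)"
  let ?U = "Matrix.mat n n (\<lambda>(i, j). coeff (p j) i)"
  have U: "Determinant.det ?U = 1"
    by (rule det_upper_unitriangular[of _ n]) (auto simp: lead deg coeff_eq_0)
  have "?V * ?U = Matrix.mat n n (\<lambda>(i, j). poly (p j) (w i))"
  proof (unfold mat_mult_mat, intro cong_mat refl, clarsimp)
    fix i j assume "i < n" "j < n"
    have "poly (p j) (w i) = (\<Sum>l\<le>j. coeff (p j) l * w i ^ l)"
      by (simp add: poly_altdef deg)
    also have "\<dots> = (\<Sum>l<n. coeff (p j) l * w i ^ l)"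
      using \<open>j < n\<close> by (intro sum.mono_neutral_left) (auto simp: coeff_eq_0 deg)
    finally show "(\<Sum>l<n. w i ^ l * coeff (p j) l) = poly (p j) (w i)"
      by (simp add: mult.commute)
  qed
  moreover have "Determinant.det (Matrix.mat n n (\<lambda>(i, j). poly (p j) (w i)))
      = prod_list (diag_mat (Matrix.mat n n (\<lambda>(i, j). poly (p j) (w i))))"
    by (rule det_lower_triangular[of n]) (auto simp: p_def poly_prod)
  moreover have "\<dots> = (\<Prod>j<n. \<Prod>i<j. (w j - w i))"
    by (simp add: prod_list_diag_prod p_def poly_prod lessThan_atLeast0)
  moreover have "Determinant.det (?V * ?U) = Determinant.det ?V * Determinant.det ?U"
    by (rule det_mult) auto
  ultimately show ?thesis using U by simp
qed

text \<open>Moving the last column to the front costs (-1)^n and splits off a 1 by 1 block; the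
  exponents add up to 0 + 1 + ... + n, which is \<open>Suc n choose 2\<close>.\<close>

lemma det_antidiagonal:
  "Determinant.det (Matrix.mat n n (\<lambda>(i, j). if i + j + 1 = n then 1 else 0 :: 'a::idom))
     = (-1) ^ (n choose 2)"
proof (induction n)
  case 0
  show ?case by (simp add: numeral_2_eq_2)
next
  case (Suc n)
  let ?J = "\<lambda>n. Matrix.mat n n (\<lambda>(i, j). if i + j + 1 = n then 1 else 0 :: 'a)"
  have "Determinant.det (?J (1 + n)) = (-1) ^ (1 * n) *
      Determinant.det (Matrix.mat (1 + n) (1 + n)
        (\<lambda>(i, j). ?J (1 + n) $$ (i, if j < 1 then j + n else j - 1)))"
    by (rule det_swap_cols) auto
  also have "Matrix.mat (1 + n) (1 + n) (\<lambda>(i, j). ?J (1 + n) $$ (i, if j < 1 then j + n else j - 1))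
      = four_block_mat (1\<^sub>m 1) (0\<^sub>m 1 n) (0\<^sub>m n 1) (?J n)"
    by (intro eq_matI) auto
  also have "Determinant.det \<dots> = Determinant.det (1\<^sub>m 1) * Determinant.det (?J n)"
    by (rule det_four_block_mat_upper_right_zero) auto
  finally show ?case
    using Suc by (simp add: numeral_2_eq_2 power_add)
qed

text \<open>Reversing rows is left multiplication by the antidiagonal matrix.\<close>

lemma det_reverse_rows:
  fixes f :: "nat \<Rightarrow> nat \<Rightarrow> 'a::idom"
  shows "Determinant.det (Matrix.mat n n (\<lambda>(i, j). f (n - 1 - i) j))
     = (-1) ^ (n choose 2) * Determinant.det (Matrix.mat n n (\<lambda>(i, j). f i j))"
proof -
  let ?J = "Matrix.mat n n (\<lambda>(i, j). if i + j + 1 = n then 1 else 0 :: 'a)"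
  have "?J * Matrix.mat n n (\<lambda>(i, j). f i j) = Matrix.mat n n (\<lambda>(i, j). f (n - 1 - i) j)"
  proof (unfold mat_mult_mat, intro cong_mat refl, clarsimp)
    fix i j assume "i < n" "j < n"
    have "(\<Sum>l<n. (if Suc (i + l) = n then 1 else 0) * f l j)
        = (\<Sum>l<n. if l = n - 1 - i then f l j else 0)"
    proof (intro sum.cong refl)
      fix l assume "l \<in> {..<n}"
      have "Suc (i + l) = n \<longleftrightarrow> l = n - 1 - i"
        using \<open>i < n\<close> by arith
      then show "(if Suc (i + l) = n then 1 else 0) * f l j = (if l = n - 1 - i then f l j else 0)"
        by simp
    qed
    also have "\<dots> = f (n - 1 - i) j"
      using \<open>i < n\<close> by simp
    finally show "(\<Sum>l<n. (if Suc (i + l) = n then 1 else 0) * f l j) = f (n - Suc i) j"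
      by simp
  qed
  moreover have "Determinant.det (?J * Matrix.mat n n (\<lambda>(i, j). f i j))
      = Determinant.det ?J * Determinant.det (Matrix.mat n n (\<lambda>(i, j). f i j))"
    by (rule det_mult) auto
  ultimately show ?thesis by (simp only: det_antidiagonal)
qed

text \<open>
  Jacobi's complementary minor theorem for the lower triangular Toeplitz matrix \<open>A\<close> of \<open>F\<close>, whose
  inverse is that of \<open>G\<close>: let \<open>X\<close> consist of the first \<open>m\<close> columns of \<open>A\<inverse>\<close> followed by \<open>n\<close> unit
  vectors, and compare the determinants in \<open>det (A X) = det X\<close>.
\<close>
lemma det_Toeplitz_dual:
  fixes F G :: "'a::idom fps"
  assumes FG: "F * G = 1" and F0: "fps_nth F 0 = 1"
  shows "Determinant.det (Matrix.mat n n (\<lambda>(i, j). fps_coeff F (int m + int i - int j)))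
    = (-1) ^ (n * m)
      * Determinant.det (Matrix.mat m m (\<lambda>(i, j). fps_coeff G (int n + int i - int j)))"
proof -
  let ?f = "\<lambda>i j. fps_coeff F (int i - int j)"
  let ?g = "\<lambda>i j. fps_coeff G (int i - int j)"
  let ?A = "Matrix.mat (m + n) (m + n) (\<lambda>(i, j). ?f i j)"
  let ?x = "\<lambda>i j. if j < m then ?g i j else if i = j - m then 1 else 0"
  let ?X = "Matrix.mat (m + n) (m + n) (\<lambda>(i, j). ?x i j)"
  let ?F = "Matrix.mat n n (\<lambda>(i, j). fps_coeff F (int m + int i - int j))"
  let ?G = "Matrix.mat m m (\<lambda>(i, j). fps_coeff G (int n + int i - int j))"
  have A: "Determinant.det ?A = 1"
    by (rule det_lower_unitriangular[of _ "m + n"]) (auto simp: F0)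
  \<comment> \<open>The Toeplitz matrices of \<open>F\<close> and \<open>G\<close> are mutually
    inverse: only \<open>j \<le> l \<le> i\<close> contributes, and that sum is a Cauchy product
    coefficient of \<open>F * G = 1\<close>.\<close>
  have conv: "(\<Sum>l<m + n. ?f i l * ?g l j) = (if i = j then 1 else 0)"
    if "i < m + n" "j < m + n" for i j
  proof (cases "j \<le> i")
    case True
    have "(\<Sum>l<m + n. ?f i l * ?g l j) = (\<Sum>l=j..i. ?f i l * ?g l j)"
      using that by (intro sum.mono_neutral_right) auto
    also have "\<dots> = (\<Sum>l=j..i. fps_nth F (i - l) * fps_nth G (l - j))"
      by (intro sum.cong) (auto simp: nat_diff_distrib')
    also have "\<dots> = (\<Sum>l=0..i - j. fps_nth G l * fps_nth F (i - j - l))"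
      using True by (intro sum.reindex_bij_witness[of _ "\<lambda>l. l + j" "\<lambda>l. l - j"]) 
        (auto simp: mult.commute diff_diff_left add.commute)
    also have "\<dots> = fps_nth (F * G) (i - j)"
      by (simp add: fps_mult_nth mult.commute[of F G])
    also have "\<dots> = (if i = j then 1 else 0)"
      using True by (simp add: FG)
    finally show ?thesis .
  next
    case False
    then have "(\<Sum>l<m + n. ?f i l * ?g l j) = 0"
      by (intro sum.neutral) auto
    then show ?thesis using False by auto
  qed
  \<comment> \<open>The first \<open>m\<close> columns of \<open>?X\<close> come from the inverse of
    \<open>?A\<close> and become unit vectors; the other \<open>n\<close> pick out the first
    \<open>n\<close> columns of \<open>?A\<close>, whose last \<open>n\<close> rows form
    \<open>?F\<close>.\<close>
  have "?A * ?X = four_block_mat (1\<^sub>m m) (Matrix.mat m n (\<lambda>(i, j). ?f i j)) (0\<^sub>m n m) ?F"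
  proof (unfold mat_mult_mat, rule eq_matI)
    fix i j
    assume "i < dim_row (four_block_mat (1\<^sub>m m) (Matrix.mat m n (\<lambda>(i, j). ?f i j)) (0\<^sub>m n m) ?F)"
      "j < dim_col (four_block_mat (1\<^sub>m m) (Matrix.mat m n (\<lambda>(i, j). ?f i j)) (0\<^sub>m n m) ?F)"
    then have ij: "i < m + n" "j < m + n" by auto
    have "(\<Sum>l<m + n. ?f i l * ?x l j) = (if j < m then if i = j then 1 else 0 else ?f i (j - m))"
    proof (cases "j < m")
      case True
      then show ?thesis using conv[OF ij] by simp
    next
      case False
      then have "(\<Sum>l<m + n. ?f i l * ?x l j) = (\<Sum>l<m + n. if l = j - m then ?f i l else 0)"
        by (intro sum.cong) auto
      also have "\<dots> = ?f i (j - m)"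
        using ij by (subst sum.delta) auto
      finally show ?thesis using False by simp
    qed
    then show "Matrix.mat (m + n) (m + n)
          (\<lambda>(i, j). \<Sum>l<m + n. (\<lambda>(i, j). ?f i j) (i, l) * (\<lambda>(i, j). ?x i j) (l, j)) $$ (i, j)
        = four_block_mat (1\<^sub>m m) (Matrix.mat m n (\<lambda>(i, j). ?f i j)) (0\<^sub>m n m) ?F $$ (i, j)"
      using ij by (auto simp: of_nat_diff)
  qed auto
  then have "Determinant.det (?A * ?X) = Determinant.det (1\<^sub>m m) * Determinant.det ?F"
    by (simp only:) (rule det_four_block_mat_lower_left_zero, auto)
  moreover have "Determinant.det (?A * ?X) = Determinant.det ?A * Determinant.det ?X"
    by (rule det_mult) auto
  ultimately have "Determinant.det ?F = Determinant.det ?X"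
    using A by simp
  \<comment> \<open>Moving the \<open>n\<close> unit vectors in front of the other \<open>m\<close>
    columns gives the sign and leaves the block \<open>?G\<close> in the last \<open>m\<close>
    rows.\<close>
  also have "\<dots> = (-1) ^ (n * m) * Determinant.det (Matrix.mat (n + m) (n + m)
      (\<lambda>(i, j). ?X $$ (i, if j < n then j + m else j - n)))"
    by (rule det_swap_cols) (auto simp: add.commute)
  also have "Matrix.mat (n + m) (n + m) (\<lambda>(i, j). ?X $$ (i, if j < n then j + m else j - n))
      = four_block_mat (1\<^sub>m n) (Matrix.mat n m (\<lambda>(i, j). ?g i j)) (0\<^sub>m m n) ?G"
    by (intro eq_matI) (auto simp: of_nat_diff)
  also have "Determinant.det \<dots> = Determinant.det (1\<^sub>m n) * Determinant.det ?G"
    by (rule det_four_block_mat_lower_left_zero) auto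
  finally show ?thesis by simp
qed

text \<open>Since (1+z)^j is the sum of \<open>j choose l\<close> times z^l, column \<open>j\<close>
  on the left is a combination of the Toeplitz columns \<open>l \<le> j\<close>; the matrix of
  binomial coefficients is upper unitriangular.\<close>

lemma det_charlier:
  "Determinant.det (Matrix.mat m m (\<lambda>(i, j). charlier (- a) (n + i) (- x + real j)))
    = Determinant.det (Matrix.mat m m (\<lambda>(i, j).
        fps_coeff (fps_binomial (- x) * fps_exp a) (int n + int i - int j)))"
proof -
  define G where "G = fps_binomial (- x) * fps_exp a"
  let ?T = "Matrix.mat m m (\<lambda>(i, j). fps_coeff G (int n + int i - int j))"
  let ?U = "Matrix.mat m m (\<lambda>(i, j). real (j choose i))"
  have "?T * ?U = Matrix.mat m m (\<lambda>(i, j). charlier (- a) (n + i) (- x + real j))"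
  proof (unfold mat_mult_mat, intro cong_mat refl, clarsimp simp del: fps_to_fls_nth)
    fix i j assume "i < m" "j < m"
    have "charlier (- a) (n + i) (- x + real j) = fps_nth (fps_binomial (real j) * G) (n + i)"
      unfolding charlier_def G_def fps_binomial_add_mult by (simp add: mult_ac)
    also have "\<dots> = (\<Sum>l=0..n + i. real (j choose l) * fps_nth G (n + i - l))"
      by (simp add: fps_mult_nth binomial_gbinomial)
    also have "\<dots> = (\<Sum>l=0..n + i. fps_coeff G (int n + int i - int l) * real (j choose l))"
      by (intro sum.cong) (auto simp: nat_diff_distrib' nat_add_distrib)
    \<comment> \<open>A common larger range connects the two sums: terms with
      \<open>l > n + i\<close> have a negative index, and those with \<open>l \<ge> m\<close> vanish
      because \<open>j < m \<le> l\<close> makes \<open>j choose l\<close> zero.\<close>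
    also have "\<dots> = (\<Sum>l<n + i + m. fps_coeff G (int n + int i - int l) * real (j choose l))"
      by (intro sum.mono_neutral_left) (use \<open>j < m\<close> in auto)
    also have "\<dots> = (\<Sum>l<m. fps_coeff G (int n + int i - int l) * real (j choose l))"
      by (intro sum.mono_neutral_right) (use \<open>j < m\<close> in auto)
    finally show "(\<Sum>l<m. fps_coeff G (int n + int i - int l) * real (j choose l))
        = charlier (- a) (n + i) (real j - x)"
      by simp
  qed
  moreover have "Determinant.det (?T * ?U) = Determinant.det ?T * Determinant.det ?U"
    by (rule det_mult) auto
  moreover have "Determinant.det ?U = 1"
    by (rule det_upper_unitriangular[of _ m]) auto
  ultimately show ?thesis by (simp add: G_def)
qed

text \<open>For fixed \<open>\<sigma>\<close> the inner sum is \<open>signof \<sigma>\<close> times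
  the determinant of \<open>A\<close> with rows permuted by \<open>\<sigma>\<close>. The two signs
  cancel, leaving the same determinant for each of the \<open>n!\<close> choices of
  \<open>\<sigma>\<close>.\<close>

lemma sum_permutations_prod:
  fixes A :: "'a::{comm_ring_1,semiring_char_0} mat"
  assumes A: "A \<in> carrier_mat n n"
  shows "(\<Sum>\<sigma> | \<sigma> permutes {0..<n}. \<Sum>\<tau> | \<tau> permutes {0..<n}.
            signof \<sigma> * signof \<tau> * (\<Prod>i=0..<n. A $$ (\<sigma> i, \<tau> i)))
         = fact n * Determinant.det A"
proof -
  have "(\<Sum>\<tau> | \<tau> permutes {0..<n}. signof \<sigma> * signof \<tau> * (\<Prod>i=0..<n. A $$ (\<sigma> i, \<tau> i)))
      = Determinant.det A" if \<sigma>: "\<sigma> permutes {0..<n}" for \<sigma>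
  proof -
    have "(\<Sum>\<tau> | \<tau> permutes {0..<n}. signof \<sigma> * signof \<tau> * (\<Prod>i=0..<n. A $$ (\<sigma> i, \<tau> i)))
        = signof \<sigma> * (\<Sum>\<tau> | \<tau> permutes {0..<n}. signof \<tau> *
            (\<Prod>i=0..<n. Matrix.mat n n (\<lambda>(i, j). A $$ (\<sigma> i, j)) $$ (i, \<tau> i)))"
      unfolding sum_distrib_left
      by (intro sum.cong refl) (auto intro!: prod.cong simp: mult.assoc permutes_in_image[OF \<sigma>])
    also have "\<dots> = signof \<sigma> * Determinant.det (Matrix.mat n n (\<lambda>(i, j). A $$ (\<sigma> i, j)))"
      by (subst det_def') auto
    also have "\<dots> = signof \<sigma> * signof \<sigma> * Determinant.det A"
      using det_permute_rows[OF A \<sigma>] by (simp add: mult.assoc)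
    finally show ?thesis by (simp add: sign_def)
  qed
  then have "(\<Sum>\<sigma> | \<sigma> permutes {0..<n}. \<Sum>\<tau> | \<tau> permutes {0..<n}.
            signof \<sigma> * signof \<tau> * (\<Prod>i=0..<n. A $$ (\<sigma> i, \<tau> i)))
      = (\<Sum>\<sigma> | \<sigma> permutes {0..<n}. Determinant.det A)"
    by (intro sum.cong) auto
  then show ?thesis by (simp add: card_permutations)
qed

subsection \<open>Multivariate Laurent expansions\<close>

lemma abs_summable_prod_PiE:
  fixes f :: "'i \<Rightarrow> 'k \<Rightarrow> 'a::{real_normed_field,banach,second_countable_topology}"
  assumes "finite I" "\<And>i. i \<in> I \<Longrightarrow> countable (B i)"
    and "\<And>i. i \<in> I \<Longrightarrow> Infinite_Sum.abs_summable_on (f i) (B i)"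
  shows "Infinite_Sum.abs_summable_on (\<lambda>k. \<Prod>i\<in>I. f i (k i)) (Pi\<^sub>E I B)"
  using assms unfolding abs_summable_equivalent by (intro abs_summable_on_prod_PiE)

text \<open>Unconditional and absolute summability agree for complex families, so the product rule
  for absolutely summable factors applies.\<close>

lemma has_sum_prod_PiE:
  fixes f :: "'i \<Rightarrow> 'k::countable \<Rightarrow> complex"
  assumes I: "finite I" and f: "\<And>i. i \<in> I \<Longrightarrow> (f i has_sum s i) (B i)"
  shows "((\<lambda>k. \<Prod>i\<in>I. f i (k i)) has_sum (\<Prod>i\<in>I. s i)) (Pi\<^sub>E I B)"
proof -
  have abs: "Infinite_Sum.abs_summable_on (f i) (B i)" if "i \<in> I" for i
    using f[OF that] summable_on_iff_abs_summable_on_complex has_sum_imp_summable by blast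
  have "Infinite_Sum.abs_summable_on (\<lambda>k. \<Prod>i\<in>I. f i (k i)) (Pi\<^sub>E I B)"
    using I abs by (intro abs_summable_prod_PiE) auto
  then have "(\<lambda>k. \<Prod>i\<in>I. f i (k i)) summable_on (Pi\<^sub>E I B)"
    by (rule abs_summable_summable)
  moreover have "infsum (\<lambda>k. \<Prod>i\<in>I. f i (k i)) (Pi\<^sub>E I B) = (\<Prod>i\<in>I. infsum (f i) (B i))"
    using I abs by (rule infsum_prod_PiE_abs)
  moreover have "\<dots> = (\<Prod>i\<in>I. s i)"
    using f by (intro prod.cong refl infsumI)
  ultimately show ?thesis by (metis has_sum_infsum)
qed

section \<open>Uniqueness of the constant coefficient\<close>

text \<open>A geometric sum in \<open>w = cis (2 * pi * k / N)\<close>: since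
  \<open>w ^ N = 1\<close>, it vanishes unless \<open>w = 1\<close>, that is, unless
  \<open>N\<close> divides \<open>k\<close>.\<close>

lemma sum_roots_of_unity_powi:
  assumes N: "N > 0"
  shows "(\<Sum>t<N. cis (2 * pi * real t / real N) powi k) = (if int N dvd k then of_nat N else 0)"
proof -
  define w where "w = cis (2 * pi * of_int k / real N)"
  have pow: "cis (2 * pi * real t / real N) powi k = w ^ t" for t
  proof -
    have "real_of_int k * (2 * pi * real t / real N) = real t * (2 * pi * of_int k / real N)"
      by simp
    then show ?thesis
      unfolding w_def Complex.DeMoivre cis_power_int by (rule arg_cong)
  qed
  have w_eq_1: "w = 1 \<longleftrightarrow> int N dvd k"
  proof -
    have "w = 1 \<longleftrightarrow> (\<exists>j::int. 2 * pi * of_int k / real N = 2 * pi * of_int j)"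
      unfolding w_def cis_conv_exp exp_eq_1 by (auto simp: mult_ac)
    also have "\<dots> \<longleftrightarrow> (\<exists>j::int. real_of_int k = of_int (int N * j))"
      using N by (intro ex_cong1) (auto simp: field_simps)
    also have "\<dots> \<longleftrightarrow> int N dvd k"
      unfolding of_int_eq_iff dvd_def ..
    finally show ?thesis .
  qed
  have "w ^ N = cis (2 * pi * of_int k)"
    using N by (simp add: w_def Complex.DeMoivre)
  also have "\<dots> = 1"
    by (metis cis_multiple_2pi Ints_of_int mult.commute mult.assoc)
  finally have wN: "w ^ N = 1" .
  show ?thesis
  proof (cases "w = 1")
    case True
    then show ?thesis using w_eq_1 by (simp add: pow)
  next
    case False
    then have "(\<Sum>t<N. w ^ t) = 0"
      using wN by (simp add: sum_gp_strict)
    then show ?thesis using w_eq_1 False by (simp add: pow)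
  qed
qed

lemma has_sum_sum:
  fixes f :: "'j \<Rightarrow> 'k \<Rightarrow> 'a::topological_comm_monoid_add"
  assumes "\<And>j. j \<in> J \<Longrightarrow> (f j has_sum s j) A"
  shows "((\<lambda>k. \<Sum>j\<in>J. f j k) has_sum (\<Sum>j\<in>J. s j)) A"
  using assms by (induction J rule: infinite_finite_induct) (auto intro!: has_sum_add)

text \<open>
  Averaging over the \<open>N\<close>-th roots of unity in every variable keeps exactly the terms whose
  exponents are all divisible by \<open>N\<close>; as \<open>N\<close> grows, only the constant term survives.
\<close>
lemma laurent_expansion_zero_imp_coeff_0:
  fixes d :: "('i \<Rightarrow> int) \<Rightarrow> complex"
  assumes I: "finite I" and r: "r > 0"
    and d: "\<And>z. \<forall>i\<in>I. 0 < norm (z i) \<and> norm (z i) < r \<Longrightarrow>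
              ((\<lambda>k. d k * (\<Prod>i\<in>I. z i powi k i)) has_sum 0) (I \<rightarrow>\<^sub>E UNIV)"
  shows "d (\<lambda>i\<in>I. 0) = 0"
proof -
  let ?P = "I \<rightarrow>\<^sub>E (UNIV :: int set)"
  define \<rho> where "\<rho> = complex_of_real (r / 2)"
  have \<rho>: "0 < norm \<rho>" "norm \<rho> < r"
    using r by (auto simp: \<rho>_def)
  define g where "g k = d k * (\<Prod>i\<in>I. \<rho> powi k i)" for k
  \<comment> \<open>The hypothesis is evaluated at \<open>\<rho>\<close> times an
    \<open>N\<close>-th root of unity in each variable and summed over all choices \<open>s\<close>
    of these roots.\<close>
  have has_sum_N: "((\<lambda>k. if \<forall>i\<in>I. int N dvd k i then g k else 0) has_sum 0) ?P"
    if N: "N > 0" for N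
  proof -
    let ?w = "\<lambda>t. cis (2 * pi * real t / real N)"
    let ?S = "I \<rightarrow>\<^sub>E {..<N}"
    have "((\<lambda>k. g k * (\<Prod>i\<in>I. ?w (s i) powi k i)) has_sum 0) ?P" for s
    proof -
      have "((\<lambda>k. d k * (\<Prod>i\<in>I. (\<rho> * ?w (s i)) powi k i)) has_sum 0) ?P"
        using \<rho> by (intro d) (auto simp: norm_mult)
      then show ?thesis
        by (simp add: g_def power_int_mult_distrib prod.distrib mult.assoc)
    qed
    then have "((\<lambda>k. \<Sum>s\<in>?S. g k * (\<Prod>i\<in>I. ?w (s i) powi k i)) has_sum (\<Sum>s\<in>?S. 0)) ?P"
      by (intro has_sum_sum)
    moreover have "(\<Sum>s\<in>?S. g k * (\<Prod>i\<in>I. ?w (s i) powi k i))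
        = of_nat N ^ card I * (if \<forall>i\<in>I. int N dvd k i then g k else 0)" for k
    proof -
      have "(\<Sum>s\<in>?S. \<Prod>i\<in>I. ?w (s i) powi k i) = (\<Prod>i\<in>I. \<Sum>t<N. ?w t powi k i)"
        using I by (subst prod_sum_PiE) auto
      also have "\<dots> = (\<Prod>i\<in>I. if int N dvd k i then of_nat N else 0)"
        using N by (simp add: sum_roots_of_unity_powi)
      also have "\<dots> = (if \<forall>i\<in>I. int N dvd k i then of_nat N ^ card I else 0)"
        using I by auto
      finally show ?thesis
        by (simp add: sum_distrib_left [symmetric] mult.commute)
    qed
    ultimately have "((\<lambda>k. of_nat N ^ card I * (if \<forall>i\<in>I. int N dvd k i then g k else 0))
        has_sum 0) ?P"
      by simp
    then show ?thesis
      using N by (subst (asm) has_sum_cmult_right_iff) auto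
  qed
  let ?o = "\<lambda>i\<in>I. 0 :: int"
  have "(g has_sum 0) ?P"
    unfolding g_def using \<rho> by (intro d) auto
  then have "(\<lambda>k. norm (g k)) summable_on ?P"
    using summable_on_iff_abs_summable_on_complex has_sum_imp_summable by blast
  then obtain S where S: "((\<lambda>k. norm (g k)) has_sum S) ?P"
    by (auto simp: summable_on_def)
  have "norm (g ?o) \<le> \<epsilon>" if \<epsilon>: "\<epsilon> > 0" for \<epsilon> :: real
  proof -
    obtain K where K: "finite K" "K \<subseteq> ?P" "dist (\<Sum>k\<in>K. norm (g k)) S \<le> \<epsilon>"
      using has_sum_finite_approximation[OF S \<epsilon>] by blast
    \<comment> \<open>Adding the zero index to \<open>K\<close> can only shrink the tail of the
      norms, and lets \<open>g ?o\<close> be isolated below.\<close>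
    define K' where "K' = insert ?o K"
    have K': "finite K'" "K' \<subseteq> ?P"
      using K by (auto simp: K'_def)
    have "(\<Sum>k\<in>K. norm (g k)) \<le> (\<Sum>k\<in>K'. norm (g k))"
      using K' by (intro sum_mono2) (auto simp: K'_def)
    then have tail: "S - (\<Sum>k\<in>K'. norm (g k)) \<le> \<epsilon>"
      using K(3) by (auto simp: dist_real_def)
    \<comment> \<open>\<open>N\<close> exceeds every exponent occurring in \<open>K'\<close> in
      absolute value, so the zero index is the only one in \<open>K'\<close> with all entries
      divisible by \<open>N\<close>.\<close>
    define N where "N = Suc (\<Sum>k\<in>K'. \<Sum>i\<in>I. nat \<bar>k i\<bar>)"
    have small: "k = ?o" if k: "k \<in> K'" "\<forall>i\<in>I. int N dvd k i" for k
    proof -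
      have "k i = 0" if i: "i \<in> I" for i
      proof -
        have "nat \<bar>k i\<bar> \<le> (\<Sum>i\<in>I. nat \<bar>k i\<bar>)"
          using I i by (intro member_le_sum) auto
        also have "\<dots> \<le> (\<Sum>k\<in>K'. \<Sum>i\<in>I. nat \<bar>k i\<bar>)"
          using K' k(1) by (intro member_le_sum[where f = "\<lambda>k. \<Sum>i\<in>I. nat \<bar>k i\<bar>"]) auto
        finally have "nat \<bar>k i\<bar> < N"
          by (simp only: N_def less_Suc_eq_le)
        then have "\<bar>k i\<bar> < int N"
          by linarith
        then show ?thesis
          using k(2) i dvd_imp_le_int[of "k i" "int N"] by force
      qed
      then show ?thesis
        using K' k(1) by (auto simp: fun_eq_iff PiE_def extensional_def)
    qed
    let ?h = "\<lambda>k. if \<forall>i\<in>I. int N dvd k i then g k else 0"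
    have "sum ?h K' = (\<Sum>k\<in>K'. if k = ?o then g ?o else 0)"
      by (intro sum.cong refl) (auto dest: small)
    also have "\<dots> = g ?o"
      using K' by (simp add: K'_def)
    finally have sum_K': "sum ?h K' = g ?o" .
    \<comment> \<open>The filtered series sums to 0, so its part outside \<open>K'\<close> equals
      \<open>- g ?o\<close>; that part is dominated by the tail of the norms, which is at most
      \<open>\<epsilon>\<close>.\<close>
    have "(?h has_sum (0 - sum ?h K')) (?P - K')"
      using K' by (intro has_sum_Diff has_sum_N) (auto simp: N_def)
    then have h: "(?h has_sum (- g ?o)) (?P - K')"
      by (simp only: sum_K') simp
    have g_tail: "((\<lambda>k. norm (g k)) has_sum (S - (\<Sum>k\<in>K'. norm (g k)))) (?P - K')"
      using K' by (intro has_sum_Diff S) auto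
    have "(\<lambda>k. norm (?h k)) summable_on (?P - K')"
      using has_sum_imp_summable[OF h] by (simp only: summable_on_iff_abs_summable_on_complex)
    then obtain T where T: "((\<lambda>k. norm (?h k)) has_sum T) (?P - K')"
      by (auto simp: summable_on_def)
    have "norm (g ?o) \<le> T"
      using norm_has_sum_bound[OF T h] by simp
    also have "T \<le> S - (\<Sum>k\<in>K'. norm (g k))"
      by (rule has_sum_mono[OF T g_tail]) auto
    finally show ?thesis using tail by simp
  qed
  then have "norm (g ?o) \<le> 0"
    by (rule field_le_epsilon[of _ 0, simplified])
  then show ?thesis
    using I by (simp add: g_def)
qed

text \<open>The difference of two expansions of \<open>F\<close> represents 0 on the smaller
  polydisc, so their constant coefficients agree and the description operator picks the given
  one.\<close>

lemma constant_term_eq: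
  assumes I: "finite I" and c: "is_laurent_expansion_at_0 I F c"
  shows "constant_term I F = c (\<lambda>i\<in>I. 0)"
  unfolding constant_term_def
proof (rule the_equality)
  fix t
  assume "\<exists>c'. is_laurent_expansion_at_0 I F c' \<and> t = c' (\<lambda>i\<in>I. 0)"
  then obtain c' where c': "is_laurent_expansion_at_0 I F c'" and t: "t = c' (\<lambda>i\<in>I. 0)"
    by blast
  obtain r where r: "r > 0" and cr: "\<And>z. \<forall>i\<in>I. 0 < norm (z i) \<and> norm (z i) < r \<Longrightarrow>
      ((\<lambda>k. c k * (\<Prod>i\<in>I. z i powi k i)) has_sum F z) (I \<rightarrow>\<^sub>E UNIV)"
    using c unfolding is_laurent_expansion_at_0_def by blast
  obtain r' where r': "r' > 0" and cr': "\<And>z. \<forall>i\<in>I. 0 < norm (z i) \<and> norm (z i) < r' \<Longrightarrow>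
      ((\<lambda>k. c' k * (\<Prod>i\<in>I. z i powi k i)) has_sum F z) (I \<rightarrow>\<^sub>E UNIV)"
    using c' unfolding is_laurent_expansion_at_0_def by blast
  have "(\<lambda>k. c' k - c k) (\<lambda>i\<in>I. 0) = 0"
  proof (rule laurent_expansion_zero_imp_coeff_0[OF I, of "min r r'"])
    fix z :: "'a \<Rightarrow> complex"
    assume "\<forall>i\<in>I. 0 < norm (z i) \<and> norm (z i) < min r r'"
    then have "((\<lambda>k. c' k * (\<Prod>i\<in>I. z i powi k i) + - (c k * (\<Prod>i\<in>I. z i powi k i)))
        has_sum (F z + - F z)) (I \<rightarrow>\<^sub>E UNIV)"
      by (intro has_sum_add) (auto simp: has_sum_uminus intro!: cr cr')
    then show "((\<lambda>k. (c' k - c k) * (\<Prod>i\<in>I. z i powi k i)) has_sum 0) (I \<rightarrow>\<^sub>E UNIV)"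
      by (simp add: left_diff_distrib)
  qed (use r r' in auto)
  then show "t = c (\<lambda>i\<in>I. 0)"
    by (simp add: t)
qed (use c in blast)

subsection \<open>The constant term\<close>

text \<open>The Taylor series times z^(-q), reindexed by \<open>k = n - q\<close>; indices below
  \<open>- q\<close> contribute zero terms.\<close>

lemma has_sum_fps_coeff:
  fixes F :: "complex fps"
  assumes z: "z \<noteq> 0" "ereal (norm z) < fps_conv_radius F"
  shows "((\<lambda>k. fps_coeff F (k + q) * z powi k) has_sum (eval_fps F z * z powi (- q))) UNIV"
proof -
  have "((\<lambda>n. fps_nth F n * z ^ n) has_sum eval_fps F z) UNIV"
    using z by (intro norm_summable_imp_has_sum norm_summable_fps sums_eval_fps)
  then have "((\<lambda>n. fps_nth F n * z ^ n * z powi (- q)) has_sum (eval_fps F z * z powi (- q))) UNIV"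
    by (rule has_sum_cmult_left)
  also have "?this \<longleftrightarrow>
      ((\<lambda>k. fps_coeff F (k + q) * z powi k) has_sum (eval_fps F z * z powi (- q))) {- q..}"
    using z by (intro has_sum_reindex_bij_witness[of _ "\<lambda>k. nat (k + q)" "\<lambda>n. int n - q"])
      (auto simp: power_int_diff power_int_minus field_simps)
  also have "\<dots> \<longleftrightarrow>
      ((\<lambda>k. fps_coeff F (k + q) * z powi k) has_sum (eval_fps F z * z powi (- q))) UNIV"
    by (intro has_sum_cong_neutral) auto
  finally show ?thesis .
qed

text \<open>Each of the two Vandermonde determinants is expanded by the Leibniz formula. Variables
  are numbered from 1 but matrix rows from 0, hence the shift \<open>j - 1\<close>.\<close>

lemma Vandermonde_square:
  fixes z :: "nat \<Rightarrow> 'a::idom"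
  shows "(\<Prod>j=1..n. \<Prod>i=1..<j. (z i - z j)\<^sup>2) =
    (\<Sum>\<sigma> | \<sigma> permutes {0..<n}. \<Sum>\<tau> | \<tau> permutes {0..<n}.
       signof \<sigma> * signof \<tau> * (\<Prod>j=1..n. z j ^ (\<sigma> (j - 1) + \<tau> (j - 1))))"
proof -
  let ?V = "Matrix.mat n n (\<lambda>(i, j). z (Suc i) ^ j)"
  have "(\<Prod>j=1..n. \<Prod>i=1..<j. (z i - z j)\<^sup>2) = (\<Prod>j<n. \<Prod>i<j. (z (Suc i) - z (Suc j))\<^sup>2)"
    by (simp only: One_nat_def prod.atLeast1_atMost_eq prod.atLeast_Suc_lessThan_Suc_shift
        lessThan_atLeast0 comp_def)
  also have "\<dots> = (\<Prod>j<n. \<Prod>i<j. (z (Suc j) - z (Suc i)))\<^sup>2"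
    by (simp add: prod_power_distrib power2_commute)
  also have "\<dots> = (Determinant.det ?V)\<^sup>2"
    by (simp only: det_Vandermonde)
  also have "Determinant.det ?V
      = (\<Sum>\<sigma> | \<sigma> permutes {0..<n}. signof \<sigma> * (\<Prod>j=1..n. z j ^ \<sigma> (j - 1)))"
  proof (subst det_def')
    show "(\<Sum>\<sigma> | \<sigma> permutes {0..<n}. signof \<sigma> * (\<Prod>i=0..<n. ?V $$ (i, \<sigma> i)))
        = (\<Sum>\<sigma> | \<sigma> permutes {0..<n}. signof \<sigma> * (\<Prod>j=1..n. z j ^ \<sigma> (j - 1)))"
    proof (intro sum.cong refl arg_cong2[of _ _ _ _ "(*)"])
      fix \<sigma> assume "\<sigma> \<in> {\<sigma>. \<sigma> permutes {0..<n}}"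
      then have "\<sigma> i < n" if "i < n" for i
        using that permutes_in_image[of \<sigma> "{0..<n}"] by simp
      then show "(\<Prod>i=0..<n. ?V $$ (i, \<sigma> i)) = (\<Prod>j=1..n. z j ^ \<sigma> (j - 1))"
        by (simp add: prod.atLeast1_atMost_eq lessThan_atLeast0)
    qed
  qed auto
  finally show ?thesis
    by (simp add: power2_eq_square sum_product power_add prod.distrib mult_ac)
qed

text \<open>For each pair of permutations the summand splits into one-variable factors, whose
  Laurent series multiply. The constant coefficients are products of Hankel entries, summed by
  \<open>sum_permutations_prod\<close>.\<close>

lemma constant_term_prod_Vandermonde_square:
  fixes F :: "complex fps"
  assumes r: "r > 0" "ereal r \<le> fps_conv_radius F"
    and f: "\<And>z. norm z < r \<Longrightarrow> f z = eval_fps F z"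
  shows "constant_term {1..n}
           (\<lambda>z. (\<Prod>j=1..n. f (z j) / z j ^ p) * (\<Prod>j=1..n. \<Prod>i=1..<j. (z i - z j)\<^sup>2))
         = fact n * Determinant.det (Matrix.mat n n (\<lambda>(i, j). fps_coeff F (int p - int i - int j)))"
proof -
  \<comment> \<open>The net order of the pole in \<open>z j\<close>: \<open>p\<close> from the
    denominator, lowered by the exponents of the two Vandermonde monomials; it may be
    negative.\<close>
  define q where "q \<sigma> \<tau> j = int p - int (\<sigma> (j - 1)) - int (\<tau> (j - 1))"
    for \<sigma> \<tau> :: "nat \<Rightarrow> nat" and j :: nat
  let ?sum = "\<lambda>g. \<Sum>\<sigma> | \<sigma> permutes {0..<n}. \<Sum>\<tau> | \<tau> permutes {0..<n}.
      signof \<sigma> * signof \<tau> * g \<sigma> \<tau> :: complex"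
  define c where "c k = ?sum (\<lambda>\<sigma> \<tau>. \<Prod>j=1..n. fps_coeff F (k j + q \<sigma> \<tau> j))" for k :: "nat \<Rightarrow> int"
  let ?A = "Matrix.mat n n (\<lambda>(i, j). fps_coeff F (int p - int i - int j))"
  let ?\<Phi> = "\<lambda>z. (\<Prod>j=1..n. f (z j) / z j ^ p) * (\<Prod>j=1..n. \<Prod>i=1..<j. (z i - z j)\<^sup>2)"
  have "is_laurent_expansion_at_0 {1..n} ?\<Phi> c"
    unfolding is_laurent_expansion_at_0_def
  proof (intro exI[of _ r] conjI allI impI r)
    fix z :: "nat \<Rightarrow> complex"
    assume z: "\<forall>j\<in>{1..n}. 0 < norm (z j) \<and> norm (z j) < r"
    let ?P = "{1..n} \<rightarrow>\<^sub>E (UNIV :: int set)"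
    have "((\<lambda>k. \<Prod>j=1..n. fps_coeff F (k j + q \<sigma> \<tau> j) * z j powi k j)
        has_sum (\<Prod>j=1..n. eval_fps F (z j) * z j powi (- q \<sigma> \<tau> j))) ?P" for \<sigma> \<tau>
    proof (rule has_sum_prod_PiE[where f = "\<lambda>j l. fps_coeff F (l + q \<sigma> \<tau> j) * z j powi l"])
      fix j assume "j \<in> {1..n}"
      then have "z j \<noteq> 0" "ereal (norm (z j)) < fps_conv_radius F"
        using z r(2) by (auto intro: less_le_trans[of _ "ereal r"])
      then show "((\<lambda>l. fps_coeff F (l + q \<sigma> \<tau> j) * z j powi l)
          has_sum (eval_fps F (z j) * z j powi (- q \<sigma> \<tau> j))) UNIV"
        by (rule has_sum_fps_coeff)
    qed auto
    then have "((\<lambda>k. ?sum (\<lambda>\<sigma> \<tau>. \<Prod>j=1..n. fps_coeff F (k j + q \<sigma> \<tau> j) * z j powi k j))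
        has_sum ?sum (\<lambda>\<sigma> \<tau>. \<Prod>j=1..n. eval_fps F (z j) * z j powi (- q \<sigma> \<tau> j))) ?P"
      by (intro has_sum_sum has_sum_cmult_right)
    moreover have "?sum (\<lambda>\<sigma> \<tau>. \<Prod>j=1..n. fps_coeff F (k j + q \<sigma> \<tau> j) * z j powi k j)
        = c k * (\<Prod>j=1..n. z j powi k j)" for k
      by (simp add: c_def prod.distrib sum_distrib_right mult.assoc del: fps_to_fls_nth)
    moreover have "?sum (\<lambda>\<sigma> \<tau>. \<Prod>j=1..n. eval_fps F (z j) * z j powi (- q \<sigma> \<tau> j)) = ?\<Phi> z"
    proof -
      have "(\<Prod>j=1..n. eval_fps F (z j) * z j powi (- q \<sigma> \<tau> j))
          = (\<Prod>j=1..n. f (z j) / z j ^ p) * (\<Prod>j=1..n. z j ^ (\<sigma> (j - 1) + \<tau> (j - 1)))" for \<sigma> \<tau>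
        unfolding prod.distrib [symmetric]
      proof (intro prod.cong refl)
        fix j assume "j \<in> {1..n}"
        then have "z j \<noteq> 0" "norm (z j) < r"
          using z by auto
        moreover have "- q \<sigma> \<tau> j = int (\<sigma> (j - 1) + \<tau> (j - 1)) - int p"
          by (simp add: q_def)
        ultimately have "z j powi (- q \<sigma> \<tau> j) = z j ^ (\<sigma> (j - 1) + \<tau> (j - 1)) / z j ^ p"
          by (metis power_int_diff power_int_of_nat)
        then show "eval_fps F (z j) * z j powi (- q \<sigma> \<tau> j)
            = f (z j) / z j ^ p * z j ^ (\<sigma> (j - 1) + \<tau> (j - 1))"
          using \<open>norm (z j) < r\<close> by (simp add: f)
      qed
      then show ?thesis
        by (simp only: Vandermonde_square sum_distrib_left mult.left_commute)
    qed
    ultimately show "((\<lambda>k. c k * (\<Prod>j\<in>{1..n}. z j powi k j)) has_sum ?\<Phi> z) ?P"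
      by (simp only:)
  qed
  then have "constant_term {1..n} ?\<Phi> = c (\<lambda>j\<in>{1..n}. 0)"
    by (intro constant_term_eq) auto
  also have "\<dots> = ?sum (\<lambda>\<sigma> \<tau>. \<Prod>i=0..<n. ?A $$ (\<sigma> i, \<tau> i))"
    unfolding c_def
  proof (intro sum.cong refl arg_cong2[of _ _ _ _ "(*)"])
    fix \<sigma> \<tau>
    assume "\<sigma> \<in> {\<sigma>. \<sigma> permutes {0..<n}}" "\<tau> \<in> {\<tau>. \<tau> permutes {0..<n}}"
    then have "\<sigma> i < n" "\<tau> i < n" if "i < n" for i
      using that permutes_in_image[of \<sigma> "{0..<n}"] permutes_in_image[of \<tau> "{0..<n}"] by simp_all
    then show "(\<Prod>j=1..n. fps_coeff F ((\<lambda>j\<in>{1..n}. 0) j + q \<sigma> \<tau> j))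
        = (\<Prod>i=0..<n. ?A $$ (\<sigma> i, \<tau> i))"
      by (simp add: prod.atLeast1_atMost_eq lessThan_atLeast0 q_def del: fps_to_fls_nth)
  qed
  also have "\<dots> = fact n * Determinant.det ?A"
    by (rule sum_permutations_prod) simp
  finally show ?thesis .
qed

section \<open>The binomial series times the exponential, over the reals and the complex
  numbers\<close>

lemma fps_coeff_binomial_exp_of_real:
  "fps_coeff (fps_binomial (complex_of_real x) * fps_exp (complex_of_real a)) k
     = complex_of_real (fps_coeff (fps_binomial x * fps_exp a) k)"
  by (simp add: fps_mult_nth gbinomial_prod_rev)

text \<open>Only a bound: the radius is infinite when \<open>x\<close> is a natural number, because
  the series then terminates.\<close>

lemma fps_conv_radius_binomial:
  fixes x :: "'a::{real_normed_field,banach}"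
  shows "1 \<le> fps_conv_radius (fps_binomial x)"
  by (simp add: fps_conv_radius_def conv_radius_gchoose)

text \<open>Identifies the principal branch used by \<open>powr\<close> with the binomial series on
  the unit disc.\<close>

lemma eval_fps_binomial:
  assumes "norm z < 1"
  shows "eval_fps (fps_binomial x) z = (1 + z :: complex) powr x"
  using gen_binomial_complex[OF assms, of x] by (simp add: eval_fps_def sums_iff)

theorem mainTheorem13:
  fixes a x :: real and n m :: nat
  assumes "a \<noteq> 0" and "n \<ge> 1" and "m \<ge> 1"
  shows "constant_term {1..n}
           (\<lambda>z. (\<Prod>j=1..n. exp (- complex_of_real a * z j)
                    * ((1 + z j) powr complex_of_real x / z j ^ (m + n - 1)))
               * (\<Prod>j=1..n. \<Prod>i=1..<j. (z i - z j)^2))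
         = complex_of_real ((-1) ^ ((n choose 2) + n * m) * fact n
             * Determinant.det (Matrix.mat m m
                 (\<lambda>(i, j). charlier (- a) (n + i) (- x + real j))))"
proof -
  define F where "F = fps_binomial x * fps_exp (- a)"
  define G where "G = fps_binomial (- x) * fps_exp a"
  \<comment> \<open>\<open>Fc\<close> is the complex copy of \<open>F\<close>: analysis takes place
    over the complex numbers, while \<open>charlier\<close> is real.\<close>
  define Fc where "Fc = fps_binomial (complex_of_real x) * fps_exp (complex_of_real (- a))"
  have "F * G = fps_binomial (x + - x) * fps_exp (- a + a)"
    unfolding F_def G_def fps_binomial_add_mult fps_exp_add_mult by (simp add: mult_ac)
  then have FG: "F * G = 1"
    by simp
  have F0: "fps_nth F 0 = 1"
    by (simp add: F_def)
  have radius: "ereal 1 \<le> fps_conv_radius Fc"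
    using fps_conv_radius_mult_ge[of 1 "fps_binomial (complex_of_real x)"
        "fps_exp (complex_of_real (- a))"] fps_conv_radius_binomial[of "complex_of_real x"]
    by (simp add: Fc_def one_ereal_def)
  have eval: "exp (- complex_of_real a * z) * (1 + z) powr complex_of_real x = eval_fps Fc z"
    if "norm z < 1" for z
  proof -
    have "ereal (norm z) < fps_conv_radius (fps_binomial (complex_of_real x))"
      using that by (intro less_le_trans[OF _ fps_conv_radius_binomial]) simp
    then show ?thesis
      using that by (simp add: Fc_def eval_fps_mult eval_fps_binomial mult.commute)
  qed
  let ?T = "\<lambda>i j. fps_coeff F (int m + int i - int j)"
  have "constant_term {1..n}
           (\<lambda>z. (\<Prod>j=1..n. exp (- complex_of_real a * z j)
                    * ((1 + z j) powr complex_of_real x / z j ^ (m + n - 1)))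
               * (\<Prod>j=1..n. \<Prod>i=1..<j. (z i - z j)^2))
      = fact n * Determinant.det (Matrix.mat n n
          (\<lambda>(i, j). fps_coeff Fc (int (m + n - 1) - int i - int j)))"
    using constant_term_prod_Vandermonde_square[OF _ radius eval, of n "m + n - 1"] by simp
  also have "Matrix.mat n n (\<lambda>(i, j). fps_coeff Fc (int (m + n - 1) - int i - int j))
      = map_mat complex_of_real (Matrix.mat n n (\<lambda>(i, j). ?T (n - 1 - i) j))"
  proof (rule eq_matI)
    fix i j
    assume "i < dim_row (map_mat complex_of_real (Matrix.mat n n (\<lambda>(i, j). ?T (n - 1 - i) j)))"
      "j < dim_col (map_mat complex_of_real (Matrix.mat n n (\<lambda>(i, j). ?T (n - 1 - i) j)))"
    then have ij: "i < n" "j < n" by auto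
    \<comment> \<open>The Hankel matrix is a Toeplitz matrix with its rows reversed;
      \<open>i < n\<close> makes the natural subtraction \<open>n - 1 - i\<close> exact.\<close>
    then have "int (m + n - 1) - int i - int j = int m + int (n - 1 - i) - int j"
      by linarith
    then have "fps_coeff Fc (int (m + n - 1) - int i - int j) = complex_of_real (?T (n - 1 - i) j)"
      unfolding Fc_def F_def by (simp only: fps_coeff_binomial_exp_of_real)
    with ij show "Matrix.mat n n (\<lambda>(i, j). fps_coeff Fc (int (m + n - 1) - int i - int j)) $$ (i, j)
        = map_mat complex_of_real (Matrix.mat n n (\<lambda>(i, j). ?T (n - 1 - i) j)) $$ (i, j)"
      by (simp only: index_mat index_map_mat dim_row_mat dim_col_mat prod.case)
  qed auto
  also have "Determinant.det \<dots>
      = of_real (Determinant.det (Matrix.mat n n (\<lambda>(i, j). ?T (n - 1 - i) j)))"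
    by (rule of_real_hom.hom_det)
  also have "Determinant.det (Matrix.mat n n (\<lambda>(i, j). ?T (n - 1 - i) j))
      = (-1) ^ (n choose 2) * Determinant.det (Matrix.mat n n (\<lambda>(i, j). ?T i j))"
    by (rule det_reverse_rows)
  also have "Determinant.det (Matrix.mat n n (\<lambda>(i, j). ?T i j)) = (-1) ^ (n * m)
      * Determinant.det (Matrix.mat m m (\<lambda>(i, j). fps_coeff G (int n + int i - int j)))"
    using FG F0 by (rule det_Toeplitz_dual)
  also have "Determinant.det (Matrix.mat m m (\<lambda>(i, j). fps_coeff G (int n + int i - int j)))
      = Determinant.det (Matrix.mat m m (\<lambda>(i, j). charlier (- a) (n + i) (- x + real j)))"
    unfolding G_def by (rule det_charlier [symmetric])
  finally show ?thesis
    by (simp add: power_add mult_ac)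
qed

end
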